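(* Let $\mathcal{H}_\Gamma:\mathcal{O}\to X_2=H^{1/2}(\Gamma)$ be an operator realizing the $\Gamma_{ER}$-detectability of the reduced system $$\frac{\partial a}{\partial t}=A_{22}a+[B_2u(t)+A_{21}y(t)],\qquad a(0)=a_0,\qquad \tilde y(t)=A_{12}a(t),$$ that is, $A_{22}-\mathcal{H}_\Gamma A_{12}$ generates a strongly continuous semigroup on $X_2$ which is $\Gamma_{ER}$-stable. Then the original system is $\Gamma_{ER}$-observable by means of the dynamical system $$\frac{\partial \varphi}{\partial t}=(A_{22}-\mathcal{H}_\Gamma A_{12})\varphi+\big[A_{22}\mathcal{H}_\Gamma-\mathcal{H}_\Gamma A_{12}\mathcal{H}_\Gamma-\mathcal{H}_\Gamma A_{11}+A_{21}\big]y(t)+\big[B_2-\mathcal{H}_\Gamma B_1\big]u(t),\qquad \varphi(0)=\varphi_0 ,$$ i.e. for all initial data $x_{1_0},x_{2_0}$, $\varphi_0$ and every control $u$, $$\lim_{t\to\infty}\big\|\big(\varphi(\cdot,t)+\mathcal{H}_\Gamma y(\cdot,t)\big)-x_2(\cdot,t)\big\|_{H^{1/2}(\Gamma)}=0 .$$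
   Context: Let $\Omega\subset\mathbb{R}^n$ be a regular bounded open set and $\Gamma\subset\partial\Omega$ a sub-region of positive measure. The state space decomposes as $X=X_1\oplus X_2$, and the component $X_2$ to be estimated is taken to be $X_2=H^{1/2}(\Gamma)$. Writing $x=(x_1,x_2)$, the state satisfies $$\frac{\partial x_1}{\partial t}=A_{11}x_1+A_{12}x_2+B_1u,\qquad \frac{\partial x_2}{\partial t}=A_{21}x_1+A_{22}x_2+B_2u,$$ with $x_1(0)=x_{1_0}$, $x_2(0)=x_{2_0}$, where $A=\begin{pmatrix} A_{11} & A_{12} \\ A_{21} & A_{22} \end{pmatrix}$ is the linear operator of a parabolic system (homogeneous boundary conditions being included in its domain) and generates a strongly continuous semigroup, $B=(B_1,B_2)$ is a control operator on $\mathbb{R}^p$, and $u\in L^2(0,\infty;\mathbb{R}^p)$. The measured output is the first component, $y(t)=x_1(t)$, with values in the output space $\mathcal{O}=X_1$; $x_2$ is the unknown part. In the reduced system, $a$ plays the role of $x_2$, and $\tilde y=A_{12}a=\frac{\partial x_1}{\partial t}-A_{11}x_1-B_1u$. A strongly continuous semigroup $(S(t))_{t\ge0}$ on $X_2=H^{1/2}(\Gamma)$ is $\Gamma_{ER}$-stable if there are $M,\alpha>0$ with $\|S(t)\|_{H^{1/2}(\Gamma)}\le Me^{-\alpha t}$ for all $t\ge0$. The reduced system is $\Gamma_{ER}$-detectable if there is an operator $\mathcal{H}_\Gamma:\mathcal{O}\to H^{1/2}(\Gamma)$ such that $A_{22}-\mathcal{H}_\Gamma A_{12}$ generates a strongly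 continuous $\Gamma_{ER}$-stable semigroup on $H^{1/2}(\Gamma)$. Standing assumption: the operators $B_2-\mathcal{H}_\Gamma B_1:\mathbb{R}^p\to X_2$ and $A_{22}\mathcal{H}_\Gamma-\mathcal{H}_\Gamma A_{12}\mathcal{H}_\Gamma-\mathcal{H}_\Gamma A_{11}+A_{21}:\mathcal{O}\to X_2$ are bounded. *)

theory Defs
  imports "HOL-Analysis.Analysis"
begin

section \<open>The boundary region and the space \<open>H\<^sup>1\<^sup>/\<^sup>2(\<Gamma>)\<close>\<close>

text \<open>Regular means of class \<open>C\<^sup>1\<close>: locally \<open>\<Omega> = {g < 0}\<close> and \<open>\<partial>\<Omega> = {g = 0}\<close> with \<open>g\<close> of class \<open>C\<^sup>1\<close>
  and without critical points.\<close>

definition regular_bounded_open :: "('e::euclidean_space) set \<Rightarrow> bool" where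
  "regular_bounded_open \<Omega> \<longleftrightarrow> open \<Omega> \<and> bounded \<Omega> \<and>
     (\<forall>z\<in>frontier \<Omega>. \<exists>U g grad. open U \<and> z \<in> U \<and> continuous_on U grad \<and>
        (\<forall>y\<in>U. (g has_derivative (\<lambda>h. grad y \<bullet> h)) (at y) \<and> grad y \<noteq> 0) \<and>
        \<Omega> \<inter> U = {y\<in>U. g y < (0::real)} \<and> frontier \<Omega> \<inter> U = {y\<in>U. g y = 0})"

definition hausdorff_content :: "nat \<Rightarrow> real \<Rightarrow> ('e::metric_space) set \<Rightarrow> ennreal" where
  "hausdorff_content d \<delta> S =
     (INF U\<in>{U. S \<subseteq> (\<Union>i. U i) \<and> (\<forall>i. bounded (U i) \<and> diameter (U i) \<le> \<delta>)}.
        \<Sum>i::nat. if U i = {} then 0 else ennreal (unit_ball_vol (real d) * (diameter (U i) / 2) ^ d))"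

text \<open>The outer measure below is a metric outer measure, so by Caratheodory's theorem it is
  countably additive on the Borel sets; the default value of \<^const>\<open>measure_of\<close> does not occur.\<close>

definition hausdorff_measure :: "nat \<Rightarrow> ('e::metric_space) measure" where
  "hausdorff_measure d =
     measure_of UNIV (sets borel) (\<lambda>S. SUP \<delta>\<in>{0<..}. hausdorff_content d \<delta> S)"

definition surface_measure :: "('e::euclidean_space) measure" where
  "surface_measure = hausdorff_measure (DIM('e) - 1)"

text \<open>The square of the Sobolev--Slobodeckij norm. The exponent of the distance is
  \<open>dim \<Gamma> + 2 s\<close> with \<open>dim \<Gamma> = DIM('e) - 1\<close> and \<open>s = 1/2\<close>.\<close>

definition H_half_sq :: "('e::euclidean_space) set \<Rightarrow> ('e \<Rightarrow> real) \<Rightarrow> ennreal" where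
  "H_half_sq \<Gamma> f =
     (let \<sigma> = restrict_space surface_measure \<Gamma> in
       (\<integral>\<^sup>+x. ennreal ((f x)\<^sup>2) \<partial>\<sigma>) +
       (\<integral>\<^sup>+x. \<integral>\<^sup>+y. ennreal ((f x - f y)\<^sup>2 / dist x y ^ DIM('e)) \<partial>\<sigma> \<partial>\<sigma>))"

definition H_half_functions :: "('e::euclidean_space) set \<Rightarrow> ('e \<Rightarrow> real) set" where
  "H_half_functions \<Gamma> = {f \<in> borel_measurable (restrict_space borel \<Gamma>). H_half_sq \<Gamma> f < \<infinity>}"

text \<open>HOL has no types depending on \<open>\<Gamma>\<close>. So \<open>H\<^sup>1\<^sup>/\<^sup>2(\<Gamma>)\<close>, whose elements are classes of functions
  modulo equality almost everywhere on \<open>\<Gamma>\<close>, is presented as a type \<open>'b\<close> together with the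
  quotient map \<open>cls\<close> sending a function to its class. The clause on norms makes the norm
  of \<open>'b\<close> the norm of \<open>H\<^sup>1\<^sup>/\<^sup>2(\<Gamma>)\<close> and identifies exactly the functions that agree almost everywhere.\<close>

definition is_H_half ::
    "('e::euclidean_space) set \<Rightarrow> (('e \<Rightarrow> real) \<Rightarrow> 'b::real_normed_vector) \<Rightarrow> bool" where
  "is_H_half \<Gamma> cls \<longleftrightarrow>
     (\<forall>f\<in>H_half_functions \<Gamma>. \<forall>g\<in>H_half_functions \<Gamma>. cls (\<lambda>x. f x + g x) = cls f + cls g) \<and>
     (\<forall>c. \<forall>f\<in>H_half_functions \<Gamma>. cls (\<lambda>x. c * f x) = c *\<^sub>R cls f) \<and>
     (\<forall>f\<in>H_half_functions \<Gamma>. norm (cls f) = sqrt (enn2real (H_half_sq \<Gamma> f))) \<and>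
     cls ` H_half_functions \<Gamma> = UNIV"


section \<open>Unbounded operators\<close>

record ('x, 'y) opr =
  odom :: "'x set"
  oapp :: "'x \<Rightarrow> 'y"

definition linear_opr :: "('x::real_vector, 'y::real_vector) opr \<Rightarrow> bool" where
  "linear_opr L \<longleftrightarrow> subspace (odom L) \<and>
     (\<forall>x\<in>odom L. \<forall>y\<in>odom L. oapp L (x + y) = oapp L x + oapp L y) \<and>
     (\<forall>c. \<forall>x\<in>odom L. oapp L (c *\<^sub>R x) = c *\<^sub>R oapp L x)"

definition opr_of :: "('x::real_normed_vector \<Rightarrow>\<^sub>L 'y::real_normed_vector) \<Rightarrow> ('x, 'y) opr" where
  "opr_of L = \<lparr>odom = UNIV, oapp = blinfun_apply L\<rparr>"

definition opr_plus :: "('x, 'y::plus) opr \<Rightarrow> ('x, 'y) opr \<Rightarrow> ('x, 'y) opr"  (infixl "+\<^sub>o" 65) where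
  "K +\<^sub>o L = \<lparr>odom = odom K \<inter> odom L, oapp = (\<lambda>x. oapp K x + oapp L x)\<rparr>"

definition opr_minus :: "('x, 'y::minus) opr \<Rightarrow> ('x, 'y) opr \<Rightarrow> ('x, 'y) opr"  (infixl "-\<^sub>o" 65) where
  "K -\<^sub>o L = \<lparr>odom = odom K \<inter> odom L, oapp = (\<lambda>x. oapp K x - oapp L x)\<rparr>"

definition opr_comp :: "('y, 'z) opr \<Rightarrow> ('x, 'y) opr \<Rightarrow> ('x, 'z) opr"  (infixl "\<circ>\<^sub>o" 70) where
  "K \<circ>\<^sub>o L = \<lparr>odom = {x \<in> odom L. oapp L x \<in> odom K}, oapp = (\<lambda>x. oapp K (oapp L x))\<rparr>"

text \<open>The matrix of operators acting on pairs with domain \<open>D\<close>. Since boundary conditions are part of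
  the domain and may couple the two components, \<open>D\<close> need not be the maximal domain
  \<open>max_block_dom\<close>.\<close>

definition max_block_dom ::
    "('a, 'a) opr \<Rightarrow> ('b, 'a) opr \<Rightarrow> ('a, 'b) opr \<Rightarrow> ('b, 'b) opr \<Rightarrow> ('a \<times> 'b) set" where
  "max_block_dom A11 A12 A21 A22 = (odom A11 \<inter> odom A21) \<times> (odom A12 \<inter> odom A22)"

definition block_opr ::
    "('a \<times> 'b) set \<Rightarrow> ('a::plus, 'a) opr \<Rightarrow> ('b::plus, 'a) opr \<Rightarrow> ('a, 'b) opr \<Rightarrow> ('b, 'b) opr
       \<Rightarrow> ('a \<times> 'b, 'a \<times> 'b) opr" where
  "block_opr D A11 A12 A21 A22 =
     \<lparr>odom = D,
      oapp = (\<lambda>(x1, x2). (oapp A11 x1 + oapp A12 x2, oapp A21 x1 + oapp A22 x2))\<rparr>"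

text \<open>An expression in unbounded operators, defined on a subspace of \<open>'x\<close>, counts as a bounded operator
  on \<open>'x\<close> if it is the restriction of a bounded operator \<open>G\<close>. If \<open>odom K\<close> is dense, \<open>G\<close> is unique.\<close>

definition bounded_extension ::
    "('x::real_normed_vector, 'y::real_normed_vector) opr \<Rightarrow> ('x \<Rightarrow>\<^sub>L 'y) \<Rightarrow> bool" where
  "bounded_extension K G \<longleftrightarrow> (\<forall>x\<in>odom K. oapp K x = blinfun_apply G x)"


section \<open>Semigroups and solutions\<close>

definition C0_semigroup :: "(real \<Rightarrow> ('x::real_normed_vector \<Rightarrow>\<^sub>L 'x)) \<Rightarrow> bool" where
  "C0_semigroup S \<longleftrightarrow> S 0 = id_blinfun \<and>
     (\<forall>s\<ge>0. \<forall>t\<ge>0. S (s + t) = S s o\<^sub>L S t) \<and>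
     (\<forall>x. ((\<lambda>t. blinfun_apply (S t) x) \<longlongrightarrow> x) (at_right 0))"

definition generates ::
    "('x::real_normed_vector, 'x) opr \<Rightarrow> (real \<Rightarrow> ('x \<Rightarrow>\<^sub>L 'x)) \<Rightarrow> bool" where
  "generates L S \<longleftrightarrow> C0_semigroup S \<and>
     odom L = {x. \<exists>y. ((\<lambda>h. (blinfun_apply (S h) x - x) /\<^sub>R h) \<longlongrightarrow> y) (at_right 0)} \<and>
     (\<forall>x\<in>odom L. ((\<lambda>h. (blinfun_apply (S h) x - x) /\<^sub>R h) \<longlongrightarrow> oapp L x) (at_right 0))"

definition ER_stable :: "(real \<Rightarrow> ('b::real_normed_vector \<Rightarrow>\<^sub>L 'b)) \<Rightarrow> bool" where
  "ER_stable S \<longleftrightarrow> (\<exists>M>0. \<exists>\<alpha>>0. \<forall>t\<ge>0. norm (S t) \<le> M * exp (- \<alpha> * t))"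

text \<open>\<open>H\<close> realizes the detectability of the system \<open>a' = A22 a + \<dots>\<close> with output \<open>A12 a\<close>.\<close>

definition realizes_ER_detectability ::
    "('a::real_normed_vector \<Rightarrow>\<^sub>L 'b::real_normed_vector) \<Rightarrow> ('b, 'b) opr \<Rightarrow> ('b, 'a) opr \<Rightarrow> bool" where
  "realizes_ER_detectability H A22 A12 \<longleftrightarrow>
     (\<exists>T. generates (A22 -\<^sub>o opr_of H \<circ>\<^sub>o A12) T \<and> ER_stable T)"

text \<open>Mild solutions of \<open>x' = L x + f\<close>, \<open>x(0) = x0\<close> on \<open>[0,\<infinity>)\<close>: the equation integrated in time, with
  \<open>L\<close> taken out of the integral. For the generator of a strongly continuous semigroup \<open>S\<close> and
  locally integrable \<open>f\<close> this is the same as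
  \<open>x(t) = S(t) x0 + \<integral>\<^sub>0\<^sup>t S(t - s) f(s) ds\<close>.\<close>

definition mild_solution ::
    "('x::banach, 'x) opr \<Rightarrow> 'x \<Rightarrow> (real \<Rightarrow> 'x) \<Rightarrow> (real \<Rightarrow> 'x) \<Rightarrow> bool" where
  "mild_solution L x0 f x \<longleftrightarrow> continuous_on {0..} x \<and>
     (\<forall>t\<ge>0. f integrable_on {0..t} \<and> integral {0..t} x \<in> odom L \<and>
        x t = x0 + oapp L (integral {0..t} x) + integral {0..t} f)"

definition L2_control :: "(real \<Rightarrow> 'u::euclidean_space) \<Rightarrow> bool" where
  "L2_control u \<longleftrightarrow> u \<in> borel_measurable (lebesgue_on {0<..}) \<and>
     integrable (lebesgue_on {0<..}) (\<lambda>t. (norm (u t))\<^sup>2)"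

end

theory Submission
  imports Defs
begin

text \<open>
  The estimation error \<open>e = (\<phi> + H x\<^sub>1) - x\<^sub>2\<close> satisfies the homogeneous equation \<open>e' = F e\<close> with
  \<open>F = A22 - H A12\<close>. The operator in front of \<open>y = x\<^sub>1\<close> in the observer is \<open>F H - H A11 + A21\<close>, so
  \<open>\<phi>' = F \<phi> + F H x\<^sub>1 - H A11 x\<^sub>1 + A21 x\<^sub>1 + (B2 - H B1) u\<close>. Adding
  \<open>H x\<^sub>1' = H A11 x\<^sub>1 + H A12 x\<^sub>2 + H B1 u\<close> and subtracting
  \<open>x\<^sub>2' = A21 x\<^sub>1 + A22 x\<^sub>2 + B2 u\<close> leaves \<open>F \<phi> + F H x\<^sub>1 - F x\<^sub>2\<close>. For mild solutions this
  computation takes place on the time integrals, which lie in the domains of the operators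
  (lemma \<open>error_mild_solution\<close>).

  A mild solution of \<open>e' = F e\<close> is necessarily the orbit \<open>S(t) e(0)\<close> of the semigroup generated by
  \<open>F\<close>, which is bounded by stability (lemma \<open>homogeneous_mild_solution_is_orbit\<close>). Indeed the integral \<open>E\<close> of \<open>e\<close> solves
  \<open>E' = F E + e(0)\<close> classically, and so \<open>s \<mapsto> S(t - s) E(s)\<close> has derivative \<open>S(t - s) e(0)\<close>; integrating
  over \<open>[0,t]\<close> gives \<open>E(t)\<close> as the integral of the orbit, and differentiating in \<open>t\<close> gives
  \<open>e(t) = S(t) e(0)\<close>. Exponential stability then makes the error tend to zero.
\<close>

section \<open>Bounded strongly continuous semigroups\<close>

lemma filterlim_abs_diff_at_right_0:
  "filterlim (\<lambda>r. \<bar>r - s\<bar>) (at_right 0) (at s within A)" for s :: real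
proof -
  have "((\<lambda>r. \<bar>r - s\<bar>) \<longlongrightarrow> \<bar>s - s\<bar>) (at s within A)"
    by (intro tendsto_intros)
  moreover have "eventually (\<lambda>r. \<bar>r - s\<bar> \<in> {0<..} \<and> \<bar>r - s\<bar> \<noteq> 0) (at s within A)"
    by (auto simp: eventually_at_filter)
  ultimately show ?thesis
    by (simp add: filterlim_at)
qed

lemma has_vector_derivative_iff_quotient:
  "(f has_vector_derivative D) (at x within A) \<longleftrightarrow>
     ((\<lambda>y. (f y - f x) /\<^sub>R (y - x)) \<longlongrightarrow> D) (at x within A)"
proof -
  have eq: "norm ((f y - f x) - (y - x) *\<^sub>R D) / norm (y - x) = norm ((f y - f x) /\<^sub>R (y - x) - D)"
    if "y \<noteq> x" for y
  proof -
    have "(f y - f x) /\<^sub>R (y - x) - D = ((f y - f x) - (y - x) *\<^sub>R D) /\<^sub>R (y - x)"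
      using that by (simp add: scaleR_diff_right)
    then show ?thesis by (simp only: norm_scaleR) (simp add: divide_inverse mult.commute)
  qed
  have "(f has_vector_derivative D) (at x within A) \<longleftrightarrow>
      ((\<lambda>y. norm ((f y - f x) - (y - x) *\<^sub>R D) / norm (y - x)) \<longlongrightarrow> 0) (at x within A)"
    unfolding has_vector_derivative_def has_derivative_iff_norm
    by (simp add: bounded_linear_scaleR_left)
  also have "\<dots> \<longleftrightarrow> ((\<lambda>y. norm ((f y - f x) /\<^sub>R (y - x) - D)) \<longlongrightarrow> 0) (at x within A)"
    by (intro tendsto_cong) (auto simp: eventually_at_filter eq simp del: real_norm_def)
  finally show ?thesis
    by (simp add: tendsto_norm_zero_iff LIM_zero_iff)
qed

lemma C0_semigroup_add:
  assumes "C0_semigroup S" "0 \<le> s" "0 \<le> t"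
  shows "S (s + t) x = S s (S t x)"
  using assms by (simp add: C0_semigroup_def)

text \<open>For \<open>r\<close> and \<open>s\<close> in either order, the difference of \<open>S(r) x\<close> and \<open>S(s) x\<close> is
  \<open>S(min r s)\<close> applied to \<open>S(\<bar>r - s\<bar>) x - x\<close> up to sign, so right continuity at \<open>0\<close> suffices.\<close>

lemma bounded_C0_semigroup_orbit_continuous:
  assumes S: "C0_semigroup S" and bd: "\<And>t. 0 \<le> t \<Longrightarrow> norm (S t) \<le> C"
  shows "continuous_on {0..} (\<lambda>t. S t x)"
  unfolding continuous_on_def
proof
  fix s :: real assume s: "s \<in> {0..}"
  have diff: "norm (S r x - S s x) \<le> C * norm (S \<bar>r - s\<bar> x - x)" if "0 \<le> r" for r
  proof -
    have "norm (S r x - S s x) = norm (S (min r s) (S \<bar>r - s\<bar> x - x))"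
    proof (cases "r \<le> s")
      case True
      then show ?thesis
        using C0_semigroup_add[OF S, of r "s - r" x] that
        by (simp add: blinfun.diff_right norm_minus_commute)
    next
      case False
      then show ?thesis
        using C0_semigroup_add[OF S, of s "r - s" x] s
        by (simp add: blinfun.diff_right)
    qed
    also have "\<dots> \<le> norm (S (min r s)) * norm (S \<bar>r - s\<bar> x - x)"
      by (rule norm_blinfun)
    also have "\<dots> \<le> C * norm (S \<bar>r - s\<bar> x - x)"
      using that s by (intro mult_right_mono bd) auto
    finally show ?thesis .
  qed
  have "((\<lambda>h. S h x) \<longlongrightarrow> x) (at_right 0)"
    using S by (simp add: C0_semigroup_def)
  then have "((\<lambda>r. S \<bar>r - s\<bar> x) \<longlongrightarrow> x) (at s within {0..})"
    by (rule filterlim_compose[OF _ filterlim_abs_diff_at_right_0])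
  then have "((\<lambda>r. C * norm (S \<bar>r - s\<bar> x - x)) \<longlongrightarrow> C * norm (x - x)) (at s within {0..})"
    by (intro tendsto_intros)
  then have lim: "((\<lambda>r. C * norm (S \<bar>r - s\<bar> x - x)) \<longlongrightarrow> 0) (at s within {0..})"
    by simp
  have "((\<lambda>r. S r x - S s x) \<longlongrightarrow> 0) (at s within {0..})"
    by (rule Lim_null_comparison[OF _ lim]) (simp add: eventually_at_filter diff)
  then show "((\<lambda>r. S r x) \<longlongrightarrow> S s x) (at s within {0..})"
    by (simp add: LIM_zero_iff)
qed

text \<open>Strong continuity and the uniform bound together give joint continuity in time and vector.
  The time \<open>\<tau>\<close> is left arbitrary because below it is \<open>t - r\<close> as well as \<open>\<bar>r - s\<bar>\<close>.\<close>

lemma bounded_C0_semigroup_tendsto: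
  assumes S: "C0_semigroup S" and bd: "\<And>t. 0 \<le> t \<Longrightarrow> norm (S t) \<le> C"
    and \<tau>: "(\<tau> \<longlongrightarrow> t) Q" and nonneg: "eventually (\<lambda>r. 0 \<le> \<tau> r) Q" and t: "0 \<le> t"
    and y: "(y \<longlongrightarrow> z) Q"
  shows "((\<lambda>r. S (\<tau> r) (y r)) \<longlongrightarrow> S t z) Q"
proof -
  have "((\<lambda>r. S (\<tau> r) z) \<longlongrightarrow> S t z) Q"
    using bounded_C0_semigroup_orbit_continuous[OF S bd] \<tau> _ _
    by (rule continuous_on_tendsto_compose) (use t nonneg in auto)
  moreover have "((\<lambda>r. S (\<tau> r) (y r - z)) \<longlongrightarrow> 0) Q"
  proof (rule Lim_null_comparison)
    show "eventually (\<lambda>r. norm (S (\<tau> r) (y r - z)) \<le> C * norm (y r - z)) Q"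
      using nonneg
    proof eventually_elim
      case (elim r)
      show ?case
        using norm_blinfun[of "S (\<tau> r)" "y r - z"] bd[OF elim]
        by (meson mult_right_mono norm_ge_zero order_trans)
    qed
    have "((\<lambda>r. C * norm (y r - z)) \<longlongrightarrow> C * norm (z - z)) Q"
      by (intro tendsto_intros y)
    then show "((\<lambda>r. C * norm (y r - z)) \<longlongrightarrow> 0) Q" by simp
  qed
  ultimately have "((\<lambda>r. S (\<tau> r) z + S (\<tau> r) (y r - z)) \<longlongrightarrow> S t z + 0) Q"
    by (rule tendsto_add)
  then show ?thesis by (simp add: blinfun.diff_right)
qed

text \<open>The product rule for \<open>S(t - s) E(s)\<close>. To the right of \<open>s\<close> the factor \<open>S(t - r)\<close> is taken out of
  the difference, to the left of \<open>s\<close> the factor \<open>S(t - s)\<close>; in both cases the generator is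
  only ever applied to \<open>E(s)\<close>, as a limit from the right at time \<open>0\<close>.\<close>

lemma semigroup_product_rule:
  assumes gen: "generates L S" and bd: "\<And>t. 0 \<le> t \<Longrightarrow> norm (S t) \<le> C"
    and E: "(E has_vector_derivative E') (at s within {0..t})" and dom: "E s \<in> odom L"
    and s: "s \<in> {0..t}"
  shows "((\<lambda>r. S (t - r) (E r)) has_vector_derivative S (t - s) (E' - oapp L (E s)))
           (at s within {0..t})"
proof -
  note S = gen[unfolded generates_def, THEN conjunct1]
  note tendsto = bounded_C0_semigroup_tendsto[OF S bd]
  let ?g = "\<lambda>r. S (t - r) (E r)"
  let ?q = "\<lambda>r. (S \<bar>r - s\<bar> (E s) - E s) /\<^sub>R \<bar>r - s\<bar>"
  have E_lim: "((\<lambda>r. (E r - E s) /\<^sub>R (r - s)) \<longlongrightarrow> E') (at s within A)" if "A \<subseteq> {0..t}" for A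
    using has_vector_derivative_within_subset[OF E that]
    by (simp add: has_vector_derivative_iff_quotient)
  have q_lim: "(?q \<longlongrightarrow> oapp L (E s)) (at s within A)" for A
  proof (rule filterlim_compose[OF _ filterlim_abs_diff_at_right_0])
    show "((\<lambda>h. (S h (E s) - E s) /\<^sub>R h) \<longlongrightarrow> oapp L (E s)) (at_right 0)"
      using gen dom by (simp add: generates_def)
  qed
  have right: "((\<lambda>r. (?g r - ?g s) /\<^sub>R (r - s)) \<longlongrightarrow> S (t - s) (E' - oapp L (E s)))
                 (at s within {s..t})"
  proof (rule Lim_transform_eventually)
    show "((\<lambda>r. S (t - r) ((E r - E s) /\<^sub>R (r - s) - ?q r)) \<longlongrightarrow> S (t - s) (E' - oapp L (E s)))
            (at s within {s..t})"
    proof (rule tendsto)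
      show "((\<lambda>r. t - r) \<longlongrightarrow> t - s) (at s within {s..t})"
        by (intro tendsto_intros)
      show "((\<lambda>r. (E r - E s) /\<^sub>R (r - s) - ?q r) \<longlongrightarrow> E' - oapp L (E s)) (at s within {s..t})"
        using s by (intro tendsto_diff E_lim q_lim) auto
    qed (use s in \<open>auto simp: eventually_at_filter\<close>)
    have "S (t - r) ((E r - E s) /\<^sub>R (r - s) - ?q r) = (?g r - ?g s) /\<^sub>R (r - s)"
      if "s < r" "r \<le> t" for r
      using C0_semigroup_add[OF S, of "t - r" "r - s" "E s"] that
      by (simp add: blinfun.diff_right blinfun.scaleR_right scaleR_diff_right)
    then show "\<forall>\<^sub>F r in at s within {s..t}.
        S (t - r) ((E r - E s) /\<^sub>R (r - s) - ?q r) = (?g r - ?g s) /\<^sub>R (r - s)"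
      by (auto simp: eventually_at_filter)
  qed
  have left: "((\<lambda>r. (?g r - ?g s) /\<^sub>R (r - s)) \<longlongrightarrow> S (t - s) (E' - oapp L (E s)))
                 (at s within {0..s})"
  proof (rule Lim_transform_eventually)
    have "((\<lambda>r. S \<bar>r - s\<bar> ((E r - E s) /\<^sub>R (r - s))) \<longlongrightarrow> S 0 E') (at s within {0..s})"
    proof (rule tendsto)
      have "((\<lambda>r. \<bar>r - s\<bar>) \<longlongrightarrow> \<bar>s - s\<bar>) (at s within {0..s})"
        by (intro tendsto_intros)
      then show "((\<lambda>r. \<bar>r - s\<bar>) \<longlongrightarrow> 0) (at s within {0..s})" by simp
    qed (use s E_lim in auto)
    moreover have "S 0 E' = E'"
      using S by (simp add: C0_semigroup_def)
    ultimately show "((\<lambda>r. S (t - s) (S \<bar>r - s\<bar> ((E r - E s) /\<^sub>R (r - s)) - ?q r))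
        \<longlongrightarrow> S (t - s) (E' - oapp L (E s))) (at s within {0..s})"
      by (intro tendsto_diff blinfun.tendsto tendsto_const q_lim) simp
    have "S (t - s) (S \<bar>r - s\<bar> ((E r - E s) /\<^sub>R (r - s)) - ?q r) = (?g r - ?g s) /\<^sub>R (r - s)"
      if "0 \<le> r" "r < s" for r
    proof -
      \<comment> \<open>Both quotients are turned round so that the step \<open>s - r\<close> is positive.\<close>
      have "inverse (r - s) = - inverse (s - r)"
        by (simp flip: inverse_minus_eq)
      then have swap: "(a - b) /\<^sub>R (r - s) = (b - a) /\<^sub>R (s - r)" for a b :: 'a
        by (simp add: scaleR_diff_right)
      show ?thesis
        unfolding swap
        using C0_semigroup_add[OF S, of "t - s" "s - r" "E r"] that s
        by (simp add: blinfun.diff_right blinfun.scaleR_right scaleR_diff_right)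
    qed
    then show "\<forall>\<^sub>F r in at s within {0..s}.
        S (t - s) (S \<bar>r - s\<bar> ((E r - E s) /\<^sub>R (r - s)) - ?q r) = (?g r - ?g s) /\<^sub>R (r - s)"
      by (auto simp: eventually_at_filter)
  qed
  have "{0..t} = {0..s} \<union> {s..t}" using s by auto
  with Lim_Un[OF left right] show ?thesis
    by (simp add: has_vector_derivative_iff_quotient)
qed

text \<open>With \<open>E\<close> the integral of \<open>x\<close> and \<open>P\<close> the integral of the orbit, \<open>S(t - s) E(s) + P(t - s)\<close> is
  constant in \<open>s\<close>; its values at \<open>t\<close> and \<open>0\<close> are \<open>E(t)\<close> and \<open>P(t)\<close>.\<close>

lemma homogeneous_mild_solution_is_orbit:
  assumes gen: "generates L S" and bd: "\<And>t. 0 \<le> t \<Longrightarrow> norm (S t) \<le> C"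
    and x: "mild_solution L x0 (\<lambda>_. 0) x" and t: "0 \<le> t"
  shows "x t = S t x0"
proof -
  note S = gen[unfolded generates_def, THEN conjunct1]
  define E where "E t = integral {0..t} x" for t
  define P where "P t = integral {0..t} (\<lambda>s. S s x0)" for t
  have x_cont: "continuous_on {0..T} x" for T
    using x by (auto simp: mild_solution_def intro: continuous_on_subset)
  have S_cont: "continuous_on {0..T} (\<lambda>s. S s x0)" for T
    by (rule continuous_on_subset[OF bounded_C0_semigroup_orbit_continuous[OF S bd]]) auto
  have E_deriv: "(E has_vector_derivative x s) (at s within {0..T})" if "s \<in> {0..T}" for s T
    unfolding E_def by (rule integral_has_vector_derivative[OF x_cont that])
  have P_deriv: "(P has_vector_derivative S s x0) (at s within {0..T})" if "s \<in> {0..T}" for s T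
    unfolding P_def by (rule integral_has_vector_derivative[OF S_cont that])
  have E_dom: "E s \<in> odom L" and E_eq: "x s - oapp L (E s) = x0" if "0 \<le> s" for s
    using x that by (auto simp: mild_solution_def E_def)
  have EP: "E T = P T" if T: "0 \<le> T" for T
  proof -
    have deriv: "((\<lambda>r. S (T - r) (E r) + P (T - r)) has_vector_derivative 0) (at s within {0..T})"
      if s: "s \<in> {0..T}" for s
    proof -
      have "((\<lambda>r. S (T - r) (E r)) has_vector_derivative S (T - s) x0) (at s within {0..T})"
        using semigroup_product_rule[OF gen bd E_deriv[OF s] E_dom s] E_eq[of s] s by auto
      moreover have "((P \<circ> (\<lambda>r. T - r)) has_vector_derivative (-1) *\<^sub>R S (T - s) x0)
          (at s within {0..T})"
      proof (rule vector_diff_chain_within)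
        show "((\<lambda>r. T - r) has_vector_derivative -1) (at s within {0..T})"
          by (auto intro!: derivative_eq_intros)
        show "(P has_vector_derivative S (T - s) x0) (at (T - s) within (\<lambda>r. T - r) ` {0..T})"
          using s by (intro has_vector_derivative_within_subset[OF P_deriv[where T = T]]) auto
      qed
      ultimately have "((\<lambda>r. S (T - r) (E r) + (P \<circ> (\<lambda>r. T - r)) r) has_vector_derivative
          S (T - s) x0 + (-1) *\<^sub>R S (T - s) x0) (at s within {0..T})"
        by (rule has_vector_derivative_add)
      then show ?thesis by simp
    qed
    obtain c where c: "\<And>s. s \<in> {0..T} \<Longrightarrow> S (T - s) (E s) + P (T - s) = c"
      using has_vector_derivative_zero_constant[OF _ deriv] by auto
    show ?thesis
      using c[of 0] c[of T] T S by (simp add: C0_semigroup_def E_def P_def)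
  qed
  \<comment> \<open>The interval reaches beyond \<open>t\<close>, so that \<open>t\<close> is a limit point of it even if \<open>t = 0\<close>.\<close>
  have "(E has_vector_derivative S t x0) (at t within {0..t + 1})"
    using P_deriv[of t "t + 1"] t EP
    by (auto intro: has_vector_derivative_transform)
  then show ?thesis
    using E_deriv[of t "t + 1"] t
    by (intro vector_derivative_unique_within[where x = t and S = "{0..t + 1}" and f = E])
       (auto simp: trivial_limit_within islimpt_Icc)
qed

section \<open>The error equation\<close>

lemma linear_opr_minus:
  assumes "linear_opr K" "linear_opr L"
  shows "linear_opr (K -\<^sub>o L)"
  using assms by (auto simp: linear_opr_def opr_minus_def subspace_inter algebra_simps)

lemma linear_opr_blinfun_comp:
  assumes "linear_opr L"
  shows "linear_opr (opr_of H \<circ>\<^sub>o L)"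
  using assms by (auto simp: linear_opr_def opr_comp_def opr_of_def blinfun.bilinear_simps)

lemma linear_opr_add_mem:
  assumes "linear_opr L" "x \<in> odom L" "y \<in> odom L"
  shows "x + y \<in> odom L" "oapp L (x + y) = oapp L x + oapp L y"
  using assms by (auto simp: linear_opr_def subspace_add)

lemma linear_opr_diff_mem:
  assumes L: "linear_opr L" and x: "x \<in> odom L" and y: "y \<in> odom L"
  shows "x - y \<in> odom L" "oapp L (x - y) = oapp L x - oapp L y"
proof -
  show xy: "x - y \<in> odom L"
    using assms by (auto simp: linear_opr_def subspace_diff)
  show "oapp L (x - y) = oapp L x - oapp L y"
    using linear_opr_add_mem(2)[OF L xy y] by simp
qed

text \<open>The integrals \<open>X\<^sub>1\<close>, \<open>X\<^sub>2\<close>, \<open>\<Phi>\<close> of \<open>x\<^sub>1\<close>, \<open>x\<^sub>2\<close>, \<open>\<phi>\<close> lie in the domains of the operators, and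
  \<open>G X\<^sub>1 = F (H X\<^sub>1) - H (A11 X\<^sub>1) + A21 X\<^sub>1\<close> because \<open>X\<^sub>1\<close> is in the domain of \<open>K\<close>. The error
  equation is homogeneous because \<open>H x\<^sub>1 - x\<^sub>2\<close> receives the input \<open>H f1 - f2\<close>, the negative of
  the one given to \<open>\<phi>\<close>.\<close>

lemma error_mild_solution:
  fixes A11 :: "('a::banach, 'a) opr" and A12 :: "('b::banach, 'a) opr"
    and A21 :: "('a, 'b) opr" and A22 :: "('b, 'b) opr"
    and H G :: "'a \<Rightarrow>\<^sub>L 'b"
  defines "F \<equiv> A22 -\<^sub>o opr_of H \<circ>\<^sub>o A12"
    and "K \<equiv> A22 \<circ>\<^sub>o opr_of H -\<^sub>o opr_of H \<circ>\<^sub>o A12 \<circ>\<^sub>o opr_of H -\<^sub>o opr_of H \<circ>\<^sub>o A11 +\<^sub>o A21"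
  assumes lin: "linear_opr A12" "linear_opr A22"
    and D: "D \<subseteq> max_block_dom A11 A12 A21 A22" "fst ` D \<subseteq> odom K"
    and G: "bounded_extension K G"
    and x: "mild_solution (block_opr D A11 A12 A21 A22) (x10, x20) (\<lambda>t. (f1 t, f2 t)) x"
    and \<phi>: "mild_solution F \<phi>0 (\<lambda>t. G (fst (x t)) + (f2 t - H (f1 t))) \<phi>"
  shows "mild_solution F (\<phi>0 + H x10 - x20) (\<lambda>_. 0) (\<lambda>t. (\<phi> t + H (fst (x t))) - snd (x t))"
  unfolding mild_solution_def
proof (intro conjI allI impI)
  have cont: "continuous_on {0..} x" "continuous_on {0..} \<phi>"
    using x \<phi> by (auto simp: mild_solution_def)
  then show "continuous_on {0..} (\<lambda>t. (\<phi> t + H (fst (x t))) - snd (x t))"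
    by (intro continuous_intros)
  have linF: "linear_opr F"
    unfolding F_def by (intro linear_opr_minus linear_opr_blinfun_comp lin)
  fix t :: real assume t: "0 \<le> t"
  show "(\<lambda>_. 0 :: 'b) integrable_on {0..t}" by (rule integrable_0)
  define X1 where "X1 = integral {0..t} (\<lambda>s. fst (x s))"
  define X2 where "X2 = integral {0..t} (\<lambda>s. snd (x s))"
  define \<Phi> where "\<Phi> = integral {0..t} \<phi>"
  define I1 where "I1 = integral {0..t} f1"
  define I2 where "I2 = integral {0..t} f2"
  have intx: "x integrable_on {0..t}" and int\<phi>: "\<phi> integrable_on {0..t}"
    by (auto intro!: integrable_continuous_real continuous_on_subset[OF cont(1)]
        continuous_on_subset[OF cont(2)])
  have intx1: "(\<lambda>s. fst (x s)) integrable_on {0..t}" and intx2: "(\<lambda>s. snd (x s)) integrable_on {0..t}"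
    using integrable_linear[OF intx bounded_linear_fst] integrable_linear[OF intx bounded_linear_snd]
    by (simp_all add: o_def)
  have X: "integral {0..t} x = (X1, X2)"
    using integral_linear[OF intx bounded_linear_fst] integral_linear[OF intx bounded_linear_snd]
    by (simp add: o_def X1_def X2_def prod_eq_iff)
  have intf: "(\<lambda>s. (f1 s, f2 s)) integrable_on {0..t}"
    using x t by (auto simp: mild_solution_def)
  have intf1: "f1 integrable_on {0..t}" and intf2: "f2 integrable_on {0..t}"
    using integrable_linear[OF intf bounded_linear_fst] integrable_linear[OF intf bounded_linear_snd]
    by (simp_all add: o_def)
  have I: "integral {0..t} (\<lambda>s. (f1 s, f2 s)) = (I1, I2)"
    using integral_linear[OF intf bounded_linear_fst] integral_linear[OF intf bounded_linear_snd]
    by (simp add: o_def I1_def I2_def prod_eq_iff)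
  have intB: "(\<lambda>s. B (g s)) integrable_on {0..t}"
    and B: "integral {0..t} (\<lambda>s. B (g s)) = B (integral {0..t} g)"
    if "g integrable_on {0..t}" for g and B :: "'a \<Rightarrow>\<^sub>L 'b"
    using integrable_linear[OF that blinfun.bounded_linear_right[of B]]
      integral_linear[OF that blinfun.bounded_linear_right[of B]]
    by (simp_all add: o_def)
  have XD: "(X1, X2) \<in> D" and x_eq: "x t = (x10, x20) + oapp (block_opr D A11 A12 A21 A22) (X1, X2) + (I1, I2)"
    using x t X I by (auto simp: mild_solution_def block_opr_def)
  have \<Phi>_dom: "\<Phi> \<in> odom F" and \<phi>_eq: "\<phi> t = \<phi>0 + oapp F \<Phi> + (G X1 + (I2 - H I1))"
  proof -
    have "integral {0..t} (\<lambda>s. G (fst (x s)) + (f2 s - H (f1 s))) = G X1 + (I2 - H I1)"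
      using intx1 intf1 intf2
      by (simp add: integral_add integral_diff integrable_diff intB B X1_def I1_def I2_def)
    then show "\<Phi> \<in> odom F" "\<phi> t = \<phi>0 + oapp F \<Phi> + (G X1 + (I2 - H I1))"
      using \<phi> t by (simp_all add: mild_solution_def \<Phi>_def)
  qed
  have X1_dom: "X1 \<in> odom K" and X2_dom: "X2 \<in> odom F"
    using D XD by (auto simp: max_block_dom_def F_def opr_minus_def opr_comp_def opr_of_def)
  have HX1_dom: "H X1 \<in> odom F"
    using X1_dom
    by (auto simp: K_def F_def opr_minus_def opr_plus_def opr_comp_def opr_of_def)
  have GX1: "G X1 = oapp F (H X1) - H (oapp A11 X1) + oapp A21 X1"
    using G X1_dom unfolding bounded_extension_def
    by (auto simp: K_def F_def opr_minus_def opr_plus_def opr_comp_def opr_of_def)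
  have E: "integral {0..t} (\<lambda>s. (\<phi> s + H (fst (x s))) - snd (x s)) = (\<Phi> + H X1) - X2"
    using int\<phi> intx1 intx2
    by (simp add: integral_add integral_diff integrable_add intB B X1_def X2_def \<Phi>_def)
  show "integral {0..t} (\<lambda>s. (\<phi> s + H (fst (x s))) - snd (x s)) \<in> odom F"
    unfolding E by (intro linear_opr_diff_mem(1) linear_opr_add_mem(1) linF \<Phi>_dom HX1_dom X2_dom)
  have "oapp F ((\<Phi> + H X1) - X2) = oapp F \<Phi> + oapp F (H X1) - oapp F X2"
    using linF \<Phi>_dom HX1_dom X2_dom by (simp add: linear_opr_diff_mem linear_opr_add_mem)
  moreover have "oapp F X2 = oapp A22 X2 - H (oapp A12 X2)"
    by (simp add: F_def opr_minus_def opr_comp_def opr_of_def)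
  ultimately show "(\<phi> t + H (fst (x t))) - snd (x t) = \<phi>0 + H x10 - x20 +
      oapp F (integral {0..t} (\<lambda>s. (\<phi> s + H (fst (x s))) - snd (x s))) + integral {0..t} (\<lambda>_. 0)"
    unfolding E by (simp add: x_eq \<phi>_eq GX1 block_opr_def blinfun.add_right algebra_simps)
qed

section \<open>Convergence of the observer\<close>

lemma ER_stable_orbit_tendsto_0:
  assumes "ER_stable S"
  shows "((\<lambda>t. S t x) \<longlongrightarrow> 0) at_top"
proof -
  obtain M \<alpha> where \<alpha>: "\<alpha> > 0" and bd: "\<And>t. t \<ge> 0 \<Longrightarrow> norm (S t) \<le> M * exp (- \<alpha> * t)"
    using assms by (auto simp: ER_stable_def)
  have "filterlim (\<lambda>t. \<alpha> * t) at_top at_top"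
    using \<alpha> by (intro filterlim_tendsto_pos_mult_at_top[OF tendsto_const _ filterlim_ident])
  then have "((\<lambda>t. exp (- (\<alpha> * t))) \<longlongrightarrow> 0) at_top"
    by (intro filterlim_compose[OF exp_at_bot]) (simp add: filterlim_uminus_at_top)
  then have lim: "((\<lambda>t. M * exp (- \<alpha> * t) * norm x) \<longlongrightarrow> 0) at_top"
    by (intro tendsto_mult_left_zero tendsto_mult_right_zero) simp
  show ?thesis
  proof (rule Lim_null_comparison[OF _ lim])
    show "\<forall>\<^sub>F t in at_top. norm (S t x) \<le> M * exp (- \<alpha> * t) * norm x"
      using eventually_ge_at_top[of 0]
    proof eventually_elim
      case (elim t)
      show ?case
        using norm_blinfun[of "S t" x] bd[OF elim] by (meson mult_right_mono norm_ge_zero order_trans)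
    qed
  qed
qed

lemma ER_stable_bounded:
  assumes "ER_stable S"
  obtains C where "\<And>t. 0 \<le> t \<Longrightarrow> norm (S t) \<le> C"
proof -
  obtain M \<alpha> where M: "M > 0" and \<alpha>: "\<alpha> > 0"
    and bd: "\<And>t. t \<ge> 0 \<Longrightarrow> norm (S t) \<le> M * exp (- \<alpha> * t)"
    using assms by (auto simp: ER_stable_def)
  show ?thesis
  proof (rule that)
    fix t :: real assume t: "0 \<le> t"
    have "M * exp (- \<alpha> * t) \<le> M * 1"
      using M \<alpha> t by (intro mult_left_mono) auto
    then show "norm (S t) \<le> M" using bd[OF t] by simp
  qed
qed

theorem theorem5p12:
  fixes \<Omega> \<Gamma> :: "(real ^ 'n) set"
    and cls :: "(real ^ 'n \<Rightarrow> real) \<Rightarrow> 'b::banach"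
    and A11 :: "('a::banach, 'a) opr" and A12 :: "('b, 'a) opr"
    and A21 :: "('a, 'b) opr" and A22 :: "('b, 'b) opr"
    and D :: "('a \<times> 'b) set"
    and B1 :: "real ^ 'p \<Rightarrow> 'a" and B2 :: "real ^ 'p \<Rightarrow> 'b"
    and H :: "'a \<Rightarrow>\<^sub>L 'b" and G :: "'a \<Rightarrow>\<^sub>L 'b"
  defines "F \<equiv> A22 -\<^sub>o opr_of H \<circ>\<^sub>o A12"
    and "K \<equiv> A22 \<circ>\<^sub>o opr_of H -\<^sub>o opr_of H \<circ>\<^sub>o A12 \<circ>\<^sub>o opr_of H -\<^sub>o opr_of H \<circ>\<^sub>o A11 +\<^sub>o A21"
  assumes "regular_bounded_open \<Omega>"
    and "\<Gamma> \<subseteq> frontier \<Omega>" and "\<Gamma> \<in> sets borel" and "emeasure surface_measure \<Gamma> > 0"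
    and "is_H_half \<Gamma> cls"
    and "linear_opr A11" and "linear_opr A12" and "linear_opr A21" and "linear_opr A22"
    and "subspace D" and "D \<subseteq> max_block_dom A11 A12 A21 A22"
    and "\<exists>S. generates (block_opr D A11 A12 A21 A22) S"
    and "linear B1" and "linear B2"
    and "bounded_linear (\<lambda>v. B2 v - H (B1 v))"
    and "fst ` D \<subseteq> odom K" and "bounded_extension K G"
    and "realizes_ER_detectability H A22 A12"
  shows "\<forall>x10 x20 \<phi>0 u x \<phi>.
     L2_control u \<longrightarrow>
     mild_solution (block_opr D A11 A12 A21 A22) (x10, x20) (\<lambda>t. (B1 (u t), B2 (u t))) x \<longrightarrow>
     mild_solution F \<phi>0 (\<lambda>t. G (fst (x t)) + (B2 (u t) - H (B1 (u t)))) \<phi> \<longrightarrow>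
     ((\<lambda>t. norm ((\<phi> t + H (fst (x t))) - snd (x t))) \<longlongrightarrow> 0) at_top"
proof (intro allI impI)
  fix x10 x20 \<phi>0 u x \<phi>
  assume x: "mild_solution (block_opr D A11 A12 A21 A22) (x10, x20) (\<lambda>t. (B1 (u t), B2 (u t))) x"
    and \<phi>: "mild_solution F \<phi>0 (\<lambda>t. G (fst (x t)) + (B2 (u t) - H (B1 (u t)))) \<phi>"
  obtain S where gen: "generates F S" and stable: "ER_stable S"
    using \<open>realizes_ER_detectability H A22 A12\<close>
    by (auto simp: realizes_ER_detectability_def F_def)
  obtain C where bd: "\<And>t. 0 \<le> t \<Longrightarrow> norm (S t) \<le> C"
    using ER_stable_bounded[OF stable] by blast
  have mild: "mild_solution F (\<phi>0 + H x10 - x20) (\<lambda>_. 0) (\<lambda>t. (\<phi> t + H (fst (x t))) - snd (x t))"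
    using error_mild_solution[OF \<open>linear_opr A12\<close> \<open>linear_opr A22\<close>
        \<open>D \<subseteq> max_block_dom A11 A12 A21 A22\<close> \<open>fst ` D \<subseteq> odom K\<close>[unfolded K_def]
        \<open>bounded_extension K G\<close>[unfolded K_def] x \<phi>[unfolded F_def]]
    by (simp add: F_def)
  have "((\<lambda>t. norm (S t (\<phi>0 + H x10 - x20))) \<longlongrightarrow> 0) at_top"
    by (intro tendsto_norm_zero ER_stable_orbit_tendsto_0 stable)
  moreover have "\<forall>\<^sub>F t in at_top. norm (S t (\<phi>0 + H x10 - x20)) =
      norm ((\<phi> t + H (fst (x t))) - snd (x t))"
    using eventually_ge_at_top[of 0]
    by eventually_elim (simp add: homogeneous_mild_solution_is_orbit[OF gen bd mild])
  ultimately show "((\<lambda>t. norm ((\<phi> t + H (fst (x t))) - snd (x t))) \<longlongrightarrow> 0) at_top"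
    by (rule Lim_transform_eventually)
qed

end
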